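(* Let $x_1,x_2,\dots$ be independent identically distributed random variables in $[0,1]$ with common probability density $f$ such that $f(x)\to c$ as $x\to0^+$ for some constant $c>0$ (the case $\beta=0$ of $f(x)\asymp c x^\beta$). Let $H_n$ be the harmonic mean of $x_1,\dots,x_n$. Then there exists a constant $\mathfrak C_1$ such that $$\lim_{n\to\infty}\mathbf E(H_n\log n)=\mathfrak C_1.$$
   Context: The harmonic mean is $H_n=1/X_n$ with $X_n=\frac1n\sum_{i=1}^n\frac1{x_i}$. *)

theory Defs
  imports "HOL-Probability.Probability"
begin

text \<open>Sequences are indexed from \<open>1\<close>; \<open>x 0\<close> is never used.  If some \<open>x i\<close> with \<open>1 \<le> i \<le> n\<close>
  is \<open>0\<close>, the convention \<open>1 / 0 = 0\<close> makes the values below deviate from the usual reading;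
  for random variables with a density this happens with probability \<open>0\<close>, so expectations are
  unaffected.\<close>

definition reciprocal_mean :: "(nat \<Rightarrow> real) \<Rightarrow> nat \<Rightarrow> real" where
  "reciprocal_mean x n = 1 / real n * (\<Sum>i=1..n. 1 / x i)"

definition harmonic_mean :: "(nat \<Rightarrow> real) \<Rightarrow> nat \<Rightarrow> real" where
  "harmonic_mean x n = 1 / reciprocal_mean x n"

end

theory Submission
  imports Defs "HOL-Real_Asymp.Real_Asymp"
begin

text \<open>With \<open>S = \<Sum>i=1..n. 1 / x i\<close>, \<open>L = ln n\<close> and \<open>\<phi> l = E (exp (- l / x 1))\<close>, writing \<open>n L / S\<close>
  as the integral of \<open>exp (- u S / (n L))\<close> over \<open>u \<ge> 0\<close> and using independence gives
  \<open>E (H\<^sub>n L) = \<integral> \<phi> (u / (n L))^n du\<close>. Since the density tends to \<open>c\<close> at \<open>0\<close>,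
  \<open>1 - \<phi> l\<close> is asymptotic to \<open>c l ln (1 / l)\<close>, so the integrand tends to \<open>exp (- c u)\<close> and the
  limit is \<open>1 / c\<close>. Domination: for \<open>u \<le> sqrt n L\<close> the asymptotics give \<open>exp (- c u / 4)\<close>;
  for larger \<open>u\<close> the bound \<open>x \<le> 1\<close> gives \<open>exp (- u / L) \<le> exp (- sqrt u)\<close>, as
  \<open>L\<^sup>2 \<le> sqrt n L\<close>.\<close>

section \<open>Behaviour at \<open>0\<close> of the Laplace transform of
  \<open>1 / X\<close>\<close>

context prob_space
begin

text \<open>From \<open>y - y^2 \<le> 1 - exp (- y)\<close> with \<open>y = l / t\<close>, keeping
  only \<open>t\<close> between \<open>l\<close> and \<open>\<delta>\<close>, where the density is
  at least \<open>a\<close>. Integrating \<open>l / t - l^2 / t^2\<close> there gives the main term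
  \<open>l * ln (\<delta> / l)\<close> and errors of order \<open>l\<close>.\<close>

lemma one_minus_laplace_reciprocal_lower:
  fixes X :: "'a \<Rightarrow> real" and f :: "real \<Rightarrow> real"
  assumes X: "distributed M lborel X (\<lambda>t. ennreal (f t))"
    and f: "\<And>t. 0 \<le> f t"
    and X0: "\<And>\<omega>. \<omega> \<in> space M \<Longrightarrow> 0 \<le> X \<omega>"
    and l: "0 < l" "l < \<delta>" and a: "0 \<le> a" "\<And>t. 0 < t \<Longrightarrow> t \<le> \<delta> \<Longrightarrow> a \<le> f t"
  shows "a * (l * ln (\<delta> / l) - l) \<le> 1 - expectation (\<lambda>\<omega>. exp (- (l / X \<omega>)))"
proof -
  have X_m[measurable]: "X \<in> borel_measurable M"
    using distributed_measurable[OF X] by simp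
  \<comment> \<open>The cut at \<open>l\<close> is where \<open>y = l / t\<close> drops below
    \<open>1\<close>, which makes \<open>y - y^2\<close> nonnegative.\<close>
  define g where "g t = (l / t - l\<^sup>2 / t\<^sup>2) * indicator {l..\<delta>} t" for t :: real
  have g_m[measurable]: "g \<in> borel_measurable borel"
    unfolding g_def by measurable
  have quad: "y - y\<^sup>2 \<le> 1 - exp (- y)" if "0 \<le> y" for y :: real
  proof -
    have "exp (- y) \<le> 1 / (1 + y)"
      using exp_ge_add_one_self[of y] that by (simp add: exp_minus field_simps)
    also have "\<dots> \<le> 1 - y + y\<^sup>2"
    proof -
      \<comment> \<open>The product equals \<open>1 + y^3\<close>.\<close>
      have "1 \<le> (1 - y + y\<^sup>2) * (1 + y)"
        using that by (simp add: algebra_simps power2_eq_square)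
      then show ?thesis using that by (simp add: field_simps)
    qed
    finally show ?thesis by simp
  qed
  have g_le: "g t \<le> 1 - exp (- (l / t))" if "0 \<le> t" for t
    using quad[of "l / t"] that l
    by (auto simp: g_def indicator_def power_divide)
  have g0: "0 \<le> g t" for t
    using l by (auto simp: g_def indicator_def field_simps power2_eq_square)
  have DG: "DERIV (\<lambda>t. l * ln t + l\<^sup>2 / t) t :> l / t - l\<^sup>2 / t\<^sup>2" if "l \<le> t" for t
    using that l by (auto intro!: derivative_eq_intros simp: field_simps power2_eq_square)
  have nn: "0 \<le> l / t - l\<^sup>2 / t\<^sup>2" if "l \<le> t" for t
    using that l by (auto simp: field_simps power2_eq_square)
  have gi: "(\<integral>t. g t \<partial>lborel) = (l * ln \<delta> + l\<^sup>2 / \<delta>) - (l * ln l + l\<^sup>2 / l)"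
    unfolding g_def using l DG nn by (intro integral_FTC_Icc_nonneg) auto
  have gI: "integrable lborel g"
    unfolding g_def[abs_def] using l DG nn
    by (intro integrable_FTC_Icc_nonneg[where F="\<lambda>t. l * ln t + l\<^sup>2 / t"]) auto
  have eI: "integrable M (\<lambda>\<omega>. exp (- (l / X \<omega>)))"
    by (rule integrable_const_bound[where B=1]) (use X0 l in auto)
  have gX: "integrable M (\<lambda>\<omega>. g (X \<omega>))"
  proof (rule integrable_const_bound[where B=1])
    show "AE \<omega> in M. norm (g (X \<omega>)) \<le> 1"
    proof (rule AE_I2)
      fix \<omega> assume "\<omega> \<in> space M"
      have "g (X \<omega>) \<le> 1 - exp (- (l / X \<omega>))" using g_le X0 \<open>\<omega> \<in> space M\<close> by blast
      also have "\<dots> \<le> 1" by simp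
      finally show "norm (g (X \<omega>)) \<le> 1" using g0[of "X \<omega>"] by simp
    qed
  qed measurable
  \<comment> \<open>The positive term \<open>l^2 / \<delta>\<close> from the upper endpoint is
    dropped.\<close>
  have "a * (l * ln (\<delta> / l) - l) \<le> a * (\<integral>t. g t \<partial>lborel)"
    using l a(1) unfolding gi by (intro mult_left_mono) (auto simp: ln_div algebra_simps power2_eq_square)
  also have "\<dots> = (\<integral>t. a * g t \<partial>lborel)" by simp
  also have "\<dots> \<le> (\<integral>t. f t * g t \<partial>lborel)"
  proof (rule integral_mono)
    \<comment> \<open>No upper bound on \<open>f\<close> is available, so integrability is
      transferred from the bounded variable \<open>g (X \<omega>)\<close>.\<close>
    show "integrable lborel (\<lambda>t. f t * g t)"
      using gX distributed_integrable[OF X, of g] f by simp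
    show "a * g t \<le> f t * g t" for t
      using a(2)[of t] l g0[of t] by (auto simp: g_def indicator_def intro!: mult_right_mono)
  qed (use gI in auto)
  also have "\<dots> = expectation (\<lambda>\<omega>. g (X \<omega>))"
    using distributed_integral[OF X, of g] f by simp
  also have "\<dots> \<le> expectation (\<lambda>\<omega>. 1 - exp (- (l / X \<omega>)))"
    using g_le X0 gX eI by (intro integral_mono) auto
  also have "\<dots> = 1 - expectation (\<lambda>\<omega>. exp (- (l / X \<omega>)))"
    using eI by (simp add: prob_space)
  finally show ?thesis .
qed

text \<open>Uses that \<open>1 - exp (- y)\<close> is at most both \<open>1\<close> and
  \<open>y\<close>, where \<open>y = l / t\<close>: the bound \<open>1\<close> up to
  \<open>l\<close>, the bound \<open>l / t\<close> from \<open>l\<close> to \<open>\<delta>\<close>,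
  and the constant \<open>l / \<delta>\<close> beyond. The last contributes at most
  \<open>l / \<delta>\<close> because the total mass is \<open>1\<close>; the other two are
  integrated against \<open>b\<close>.\<close>

lemma one_minus_laplace_reciprocal_upper:
  fixes X :: "'a \<Rightarrow> real" and f :: "real \<Rightarrow> real"
  assumes X: "distributed M lborel X (\<lambda>t. ennreal (f t))"
    and f: "\<And>t. 0 \<le> f t"
    and X0: "\<And>\<omega>. \<omega> \<in> space M \<Longrightarrow> 0 \<le> X \<omega>"
    and l: "0 < l" "l < \<delta>" and b: "\<And>t. 0 < t \<Longrightarrow> t \<le> \<delta> \<Longrightarrow> f t \<le> b"
  shows "1 - expectation (\<lambda>\<omega>. exp (- (l / X \<omega>))) \<le> l / \<delta> + b * (l + l * ln (\<delta> / l))"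
proof -
  have X_m[measurable]: "X \<in> borel_measurable M"
    using distributed_measurable[OF X] by simp
  \<comment> \<open>Both pieces contain \<open>l\<close>, so \<open>g l = 2\<close>; this explains
    the bound \<open>2\<close> below and does not affect the integral. Excluding \<open>0\<close>
    keeps the support of \<open>g\<close> inside the range where \<open>f t \<le> b\<close> is
    assumed.\<close>
  define g where "g t = indicator {0<..l} t + (l / t) * indicator {l..\<delta>} t" for t :: real
  have g_m[measurable]: "g \<in> borel_measurable borel"
    unfolding g_def by measurable
  have g_ge: "1 - exp (- (l / t)) \<le> l / \<delta> + g t" if t: "0 \<le> t" for t
  proof -
    have le: "1 - exp (- (l / t)) \<le> l / t"
      using exp_ge_add_one_self[of "- (l / t)"] by simp
    consider "t = 0" | "0 < t" "t \<le> l" | "l < t" "t \<le> \<delta>" | "\<delta> < t" using t by linarith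
    then show ?thesis
    proof cases
      \<comment> \<open>Division by zero gives \<open>l / t = 0\<close>, so the left side
        vanishes.\<close>
      case 1 then show ?thesis using l by (simp add: g_def)
    next
      case 2
      have "1 - exp (- (l / t)) \<le> 1" by simp
      also have "\<dots> \<le> g t" using 2 l by (simp add: g_def)
      also have "\<dots> \<le> l / \<delta> + g t" using l by simp
      finally show ?thesis .
    next
      case 3
      have "l / t = g t" using 3 l by (simp add: g_def)
      moreover have "0 \<le> l / \<delta>" using l by simp
      ultimately show ?thesis using le by linarith
    next
      case 4
      have "l / t \<le> l / \<delta>" using 4 l by (intro divide_left_mono) auto
      moreover have "g t = 0" using 4 l by (simp add: g_def)
      ultimately show ?thesis using le by linarith
    qed
  qed
  have g0: "0 \<le> g t" for t
    using l by (auto simp: g_def indicator_def)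
  have g2: "g t \<le> 2" for t
    using l by (auto simp: g_def indicator_def field_simps)
  have DG: "DERIV (\<lambda>t. l * ln t) t :> l / t" if "l \<le> t" for t
    using that l by (auto intro!: derivative_eq_intros)
  have I2: "integrable lborel (\<lambda>t. (l / t) * indicator {l..\<delta>} t)"
    using l DG by (intro integrable_FTC_Icc_nonneg[where F="\<lambda>t. l * ln t"]) auto
  have i2: "(\<integral>t. (l / t) * indicator {l..\<delta>} t \<partial>lborel) = l * ln \<delta> - l * ln l"
    using l DG by (intro integral_FTC_Icc_nonneg) auto
  have I1: "integrable lborel (indicator {0<..l} :: real \<Rightarrow> real)"
    using l by simp
  have gI: "integrable lborel g"
    unfolding g_def[abs_def] by (intro Bochner_Integration.integrable_add I1 I2)
  have gi: "(\<integral>t. g t \<partial>lborel) = l + (l * ln \<delta> - l * ln l)"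
    unfolding g_def using l i2 by (subst Bochner_Integration.integral_add[OF I1 I2]) simp
  have eI: "integrable M (\<lambda>\<omega>. exp (- (l / X \<omega>)))"
    by (rule integrable_const_bound[where B=1]) (use X0 l in auto)
  have gX: "integrable M (\<lambda>\<omega>. g (X \<omega>))"
    by (rule integrable_const_bound[where B=2]) (use g0 g2 in auto)
  have "1 - expectation (\<lambda>\<omega>. exp (- (l / X \<omega>))) = expectation (\<lambda>\<omega>. 1 - exp (- (l / X \<omega>)))"
    using eI by (simp add: prob_space)
  also have "\<dots> \<le> expectation (\<lambda>\<omega>. l / \<delta> + g (X \<omega>))"
    using g_ge X0 gX eI by (intro integral_mono) auto
  also have "\<dots> = l / \<delta> + expectation (\<lambda>\<omega>. g (X \<omega>))"
    using gX by (simp add: prob_space)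
  also have "expectation (\<lambda>\<omega>. g (X \<omega>)) = (\<integral>t. f t * g t \<partial>lborel)"
    using distributed_integral[OF X, of g] f by simp
  also have "\<dots> \<le> (\<integral>t. b * g t \<partial>lborel)"
  proof (rule integral_mono)
    show "integrable lborel (\<lambda>t. f t * g t)"
      using gX distributed_integrable[OF X, of g] f by simp
    show "f t * g t \<le> b * g t" for t
    proof (cases "0 < t \<and> t \<le> \<delta>")
      case True
      then show ?thesis using b[of t] g0[of t] by (intro mult_right_mono) auto
    next
      case False
      then have "g t = 0" using l by (auto simp: g_def)
      then show ?thesis by simp
    qed
  qed (use gI in auto)
  also have "\<dots> = b * (l + l * ln (\<delta> / l))"
    using l by (simp add: gi ln_div algebra_simps)
  finally show ?thesis by simp
qed

text \<open>On a small interval to the right of \<open>0\<close> the density lies between constants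
  arbitrarily close to \<open>c\<close>. Since \<open>ln (\<delta> / l)\<close> is asymptotic to
  \<open>ln (1 / l)\<close> for fixed \<open>\<delta>\<close>, the two preceding bounds, divided by
  \<open>l * ln (1 / l)\<close>, tend to these constants.\<close>

lemma laplace_reciprocal_asymp:
  fixes X :: "'a \<Rightarrow> real" and f :: "real \<Rightarrow> real"
  assumes X: "distributed M lborel X (\<lambda>t. ennreal (f t))"
    and f: "\<And>t. 0 \<le> f t"
    and X0: "\<And>\<omega>. \<omega> \<in> space M \<Longrightarrow> 0 \<le> X \<omega>"
    and c: "0 < c" and lim: "(f \<longlongrightarrow> c) (at_right 0)"
  shows "((\<lambda>l. (1 - expectation (\<lambda>\<omega>. exp (- (l / X \<omega>)))) / (l * ln (1 / l))) \<longlongrightarrow> c) (at_right 0)"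
proof (rule order_tendstoI)
  fix a assume "a < c"
  \<comment> \<open>The maximum with \<open>0\<close> is taken because the lower bound requires a
    nonnegative constant.\<close>
  then obtain a' where a': "max a 0 < a'" "a' < c" using c dense[of "max a 0" c] by auto
  have "\<forall>\<^sub>F t in at_right 0. a' < f t" using lim a' by (simp add: order_tendsto_iff)
  then obtain d where d: "d > 0" "\<And>t. 0 < t \<Longrightarrow> t < d \<Longrightarrow> a' < f t"
    by (auto simp: eventually_at_right_field)
  \<comment> \<open>Halving turns the strict condition \<open>t < d\<close> into the closed range
    \<open>t \<le> \<delta>\<close>.\<close>
  define \<delta> where "\<delta> = d / 2"
  have \<delta>: "0 < \<delta>" using d by (simp add: \<delta>_def)
  have le: "\<And>t. 0 < t \<Longrightarrow> t \<le> \<delta> \<Longrightarrow> a' \<le> f t" using d by (auto simp: \<delta>_def intro!: less_imp_le)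
  have "((\<lambda>l. a' * (ln (\<delta> / l) - 1) / ln (1 / l)) \<longlongrightarrow> a') (at_right 0)"
    using \<delta> a' by real_asymp
  then have "\<forall>\<^sub>F l in at_right 0. a < a' * (ln (\<delta> / l) - 1) / ln (1 / l)"
    using a' by (auto simp: order_tendsto_iff)
  moreover have "\<forall>\<^sub>F l in at_right 0. 0 < l \<and> l < \<delta> \<and> l < 1"
    using \<delta> by (auto simp: eventually_at_right_field intro!: exI[of _ "min \<delta> 1"])
  ultimately show "\<forall>\<^sub>F l in at_right 0. a < (1 - expectation (\<lambda>\<omega>. exp (- (l / X \<omega>)))) / (l * ln (1 / l))"
  proof eventually_elim
    case (elim l)
    have ln: "0 < l * ln (1 / l)" using elim by (intro mult_pos_pos) (auto simp: ln_div)
    have "a' * (ln (\<delta> / l) - 1) / ln (1 / l) = a' * (l * ln (\<delta> / l) - l) / (l * ln (1 / l))"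
      using elim ln by (simp add: field_simps)
    also have "\<dots> \<le> (1 - expectation (\<lambda>\<omega>. exp (- (l / X \<omega>)))) / (l * ln (1 / l))"
      using elim ln a' le
      by (intro divide_right_mono one_minus_laplace_reciprocal_lower[OF X f X0]) auto
    finally show ?case using elim by linarith
  qed
next
  fix b assume "c < b"
  then obtain b' where b': "c < b'" "b' < b" using dense by blast
  have "\<forall>\<^sub>F t in at_right 0. f t < b'" using lim b' by (simp add: order_tendsto_iff)
  then obtain d where d: "d > 0" "\<And>t. 0 < t \<Longrightarrow> t < d \<Longrightarrow> f t < b'"
    by (auto simp: eventually_at_right_field)
  define \<delta> where "\<delta> = d / 2"
  have \<delta>: "0 < \<delta>" using d by (simp add: \<delta>_def)
  have le: "\<And>t. 0 < t \<Longrightarrow> t \<le> \<delta> \<Longrightarrow> f t \<le> b'" using d by (auto simp: \<delta>_def intro!: less_imp_le)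
  have "((\<lambda>l. (1 / \<delta> + b' * (1 + ln (\<delta> / l))) / ln (1 / l)) \<longlongrightarrow> b') (at_right 0)"
    using \<delta> b' c by real_asymp
  then have "\<forall>\<^sub>F l in at_right 0. (1 / \<delta> + b' * (1 + ln (\<delta> / l))) / ln (1 / l) < b"
    using b' by (auto simp: order_tendsto_iff)
  moreover have "\<forall>\<^sub>F l in at_right 0. 0 < l \<and> l < \<delta> \<and> l < 1"
    using \<delta> by (auto simp: eventually_at_right_field intro!: exI[of _ "min \<delta> 1"])
  ultimately show "\<forall>\<^sub>F l in at_right 0. (1 - expectation (\<lambda>\<omega>. exp (- (l / X \<omega>)))) / (l * ln (1 / l)) < b"
  proof eventually_elim
    case (elim l)
    have ln: "0 < l * ln (1 / l)" using elim by (intro mult_pos_pos) (auto simp: ln_div)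
    have "(1 - expectation (\<lambda>\<omega>. exp (- (l / X \<omega>)))) / (l * ln (1 / l))
        \<le> (l / \<delta> + b' * (l + l * ln (\<delta> / l))) / (l * ln (1 / l))"
      using elim ln le
      by (intro divide_right_mono one_minus_laplace_reciprocal_upper[OF X f X0]) auto
    also have "\<dots> = (l * (1 / \<delta> + b' * (1 + ln (\<delta> / l)))) / (l * ln (1 / l))"
      by (simp add: algebra_simps)
    also have "\<dots> = (1 / \<delta> + b' * (1 + ln (\<delta> / l))) / ln (1 / l)"
      using elim by simp
    finally show ?case using elim by linarith
  qed
qed

end

section \<open>Exponential integrals on the half-line\<close>

text \<open>Turns the reciprocal of a sum into an exponential of that sum, which factorises under
  independence. The nonnegative form allows the order of integration to be exchanged without an
  integrability check.\<close>

lemma nn_integral_exp_scaled: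
  fixes r :: real
  assumes "0 < r"
  shows "(\<integral>\<^sup>+u. ennreal (exp (- (u * r))) * indicator {0..} u \<partial>lborel) = ennreal (1 / r)"
proof -
  have "(\<integral>\<^sup>+u. ennreal (exp (- (u * r))) * indicator {0..} u \<partial>lborel) = ennreal (0 - (- exp (- (0 * r)) / r))"
  proof (rule nn_integral_FTC_atLeast)
    show "DERIV (\<lambda>u. - exp (- (u * r)) / r) u :> exp (- (u * r))" for u
      using assms by (auto intro!: derivative_eq_intros)
    show "((\<lambda>u. - exp (- (u * r)) / r) \<longlongrightarrow> 0) at_top"
      using assms by real_asymp
  qed auto
  then show ?thesis by simp
qed

lemma integrable_exp_scaled:
  fixes r :: real
  assumes "0 < r"
  shows "integrable lborel (\<lambda>u. exp (- (u * r)) * indicator {0..} u)"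
proof (rule integrableI_nonneg)
  have "(\<integral>\<^sup>+u. ennreal (exp (- (u * r)) * indicator {0..} u) \<partial>lborel)
      = (\<integral>\<^sup>+u. ennreal (exp (- (u * r))) * indicator {0..} u \<partial>lborel)"
    by (intro nn_integral_cong) (auto simp: indicator_def)
  then show "(\<integral>\<^sup>+u. ennreal (exp (- (u * r)) * indicator {0..} u) \<partial>lborel) < \<infinity>"
    using nn_integral_exp_scaled[OF assms] by simp
qed auto

text \<open>Comparison with \<open>24 / (1 + u)^2\<close>, which has an explicit primitive. The
  function serves as the tail of the dominating function.\<close>

lemma integrable_exp_minus_sqrt:
  "integrable lborel (\<lambda>u. exp (- sqrt u) * indicator {0..} u)"
proof (rule Bochner_Integration.integrable_bound)
  have "(\<integral>\<^sup>+u. ennreal (24 / (1 + u)\<^sup>2) * indicator {0..} u \<partial>lborel) = ennreal (0 - (- 24 / (1 + 0)))"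
  proof (rule nn_integral_FTC_atLeast)
    show "DERIV (\<lambda>u::real. - 24 / (1 + u)) u :> 24 / (1 + u)\<^sup>2" if "0 \<le> u" for u :: real
      using that by (auto intro!: derivative_eq_intros simp: power2_eq_square)
    show "((\<lambda>u::real. - 24 / (1 + u)) \<longlongrightarrow> 0) at_top" by real_asymp
  qed auto
  moreover have "(\<integral>\<^sup>+u. ennreal (24 / (1 + u)\<^sup>2 * indicator {0..} u) \<partial>lborel)
      = (\<integral>\<^sup>+u. ennreal (24 / (1 + u)\<^sup>2) * indicator {0..} u \<partial>lborel)"
    by (intro nn_integral_cong) (auto simp: indicator_def)
  ultimately show "integrable lborel (\<lambda>u::real. 24 / (1 + u)\<^sup>2 * indicator {0..} u)"
    by (intro integrableI_nonneg) auto
  have "exp (- sqrt u) \<le> 24 / (1 + u)\<^sup>2" if "0 \<le> u" for u :: real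
  proof -
    define s where "s = sqrt u"
    have s: "0 \<le> s" "u = s\<^sup>2" using that by (auto simp: s_def)
    \<comment> \<open>Degree \<open>4\<close> is needed to reach \<open>u^2 = s^4\<close>; its
      coefficient \<open>1 / 4!\<close> is the source of the constant \<open>24\<close>.\<close>
    have "(\<Sum>k<5. s ^ k /\<^sub>R fact k) \<le> exp s"
      unfolding exp_def using s summable_exp_generic[of s]
      by (intro sum_le_suminf) auto
    then have "1 + s + s ^ 2 / 2 + s ^ 3 / 6 + s ^ 4 / 24 \<le> exp s"
      by (simp add: eval_nat_numeral divide_simps algebra_simps)
    moreover have "0 \<le> s ^ 2" "0 \<le> s ^ 3" "(s\<^sup>2)\<^sup>2 = s ^ 4" using s by (auto simp flip: power_mult)
    moreover have "(1 + u)\<^sup>2 = 1 + 2 * s\<^sup>2 + s ^ 4"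
      using s \<open>(s\<^sup>2)\<^sup>2 = s ^ 4\<close> by (simp add: power2_sum)
    ultimately have "(1 + u)\<^sup>2 \<le> 24 * exp s" using s(1) by linarith
    then show ?thesis using that unfolding s_def[symmetric]
      by (simp add: exp_minus field_simps)
  qed
  then show "AE u in lborel. norm (exp (- sqrt u) * indicator {0..} u)
      \<le> norm (24 / (1 + u)\<^sup>2 * indicator {0..} u :: real)"
    by (intro AE_I2) (auto simp: indicator_def)
qed auto


section \<open>Pointwise limit and domination of the powers\<close>

text \<open>For \<open>l = u / (n ln n)\<close> the quantity \<open>n * l * ln (1 / l)\<close> tends
  to \<open>u\<close>, because \<open>ln (1 / l)\<close> is asymptotic to \<open>ln n\<close>; this
  is what fixes the factor \<open>ln n\<close>. Hence \<open>n * (1 - \<phi> l)\<close> tends to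
  \<open>c * u\<close>, and the power behaves like \<open>(1 - c * u / n)^n\<close>.\<close>

lemma laplace_power_tendsto:
  fixes \<phi> :: "real \<Rightarrow> real"
  assumes lim: "((\<lambda>l. (1 - \<phi> l) / (l * ln (1 / l))) \<longlongrightarrow> c) (at_right 0)"
    and c: "0 < c" and u: "0 < u"
  shows "(\<lambda>n. \<phi> (u / (real n * ln (real n))) ^ n) \<longlonglongrightarrow> exp (- (u * c))"
proof -
  define l where "l n = u / (real n * ln (real n))" for n :: nat
  define y where "y n = 1 - \<phi> (l n)" for n
  have l0: "filterlim l (at_right 0) sequentially"
    unfolding l_def using u by real_asymp
  have l1: "\<forall>\<^sub>F n in sequentially. 0 < l n \<and> l n < 1"
  proof -
    have "\<forall>\<^sub>F z in at_right (0::real). 0 < z \<and> z < 1"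
      by (auto simp: eventually_at_right_field intro!: exI[of _ 1])
    then show ?thesis using l0 unfolding filterlim_iff by blast
  qed
  have "(\<lambda>n. real n * l n * ln (1 / l n)) \<longlonglongrightarrow> u"
    unfolding l_def using u by real_asymp
  from tendsto_mult[OF filterlim_compose[OF lim l0] this]
  have "(\<lambda>n. (1 - \<phi> (l n)) / (l n * ln (1 / l n)) * (real n * l n * ln (1 / l n))) \<longlonglongrightarrow> c * u" .
  moreover have "\<forall>\<^sub>F n in sequentially.
      (1 - \<phi> (l n)) / (l n * ln (1 / l n)) * (real n * l n * ln (1 / l n)) = real n * y n"
    using l1 by eventually_elim (auto simp: y_def ln_div)
  ultimately have p: "(\<lambda>n. real n * y n) \<longlonglongrightarrow> c * u"
    by (rule Lim_transform_eventually)
  \<comment> \<open>A positive limit makes \<open>y n\<close> eventually positive, so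
    \<open>y\<close> tends to \<open>0\<close> from the right and dividing by \<open>y n\<close> is
    legitimate.\<close>
  have cu: "0 < c * u" using c u by simp
  have "\<forall>\<^sub>F n in sequentially. 0 < real n * y n"
    using order_tendstoD(1)[OF p cu] .
  then have y_pos: "\<forall>\<^sub>F n in sequentially. 0 < y n"
    by eventually_elim (simp add: zero_less_mult_iff)
  have "(\<lambda>n. real n * y n * (1 / real n)) \<longlonglongrightarrow> c * u * 0"
    by (intro tendsto_mult p lim_1_over_n)
  moreover have "\<forall>\<^sub>F n in sequentially. real n * y n * (1 / real n) = y n"
    using eventually_gt_at_top[of 0] by eventually_elim simp
  ultimately have y0: "y \<longlonglongrightarrow> 0"
    by (auto intro: Lim_transform_eventually)
  have yr: "filterlim y (at_right 0) sequentially"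
    using y0 y_pos by (auto simp: filterlim_at elim: eventually_mono)
  \<comment> \<open>The logarithm of the power is split as \<open>n * y n\<close> times
    \<open>ln (1 - y n) / y n\<close>.\<close>
  have "((\<lambda>z::real. ln (1 - z) / z) \<longlongrightarrow> - 1) (at_right 0)" by real_asymp
  from tendsto_mult[OF p filterlim_compose[OF this yr]]
  have "(\<lambda>n. exp (real n * y n * (ln (1 - y n) / y n))) \<longlonglongrightarrow> exp (c * u * - 1)"
    by (rule tendsto_exp)
  moreover have "\<forall>\<^sub>F n in sequentially. y n < 1"
    using order_tendstoD(2)[OF y0, of 1] by simp
  with y_pos have "\<forall>\<^sub>F n in sequentially. exp (real n * y n * (ln (1 - y n) / y n)) = \<phi> (l n) ^ n"
  proof eventually_elim
    case (elim n)
    have "exp (real n * y n * (ln (1 - y n) / y n)) = exp (real n * ln (1 - y n))"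
      using elim by simp
    also have "\<dots> = (1 - y n) ^ n" using elim by (simp add: exp_of_nat_mult)
    finally show ?case by (simp add: y_def)
  qed
  ultimately have "(\<lambda>n. \<phi> (l n) ^ n) \<longlonglongrightarrow> exp (c * u * - 1)"
    by (rule Lim_transform_eventually)
  then show ?thesis by (simp add: l_def mult.commute)
qed

text \<open>Adding the bounds for small and large \<open>u\<close> removes the threshold, which
  depends on \<open>n\<close>, and leaves one integrable function. In \<open>c / 4\<close> one
  factor \<open>1 / 2\<close> comes from replacing the limit \<open>c\<close> by
  \<open>c / 2\<close>, the other from \<open>ln (1 / l) \<ge> ln n / 2\<close>.\<close>

lemma laplace_power_dominated:
  fixes \<phi> :: "real \<Rightarrow> real"
  assumes lim: "((\<lambda>l. (1 - \<phi> l) / (l * ln (1 / l))) \<longlongrightarrow> c) (at_right 0)"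
    and c: "0 < c"
    and nonneg: "\<And>l. 0 \<le> \<phi> l" and le: "\<And>l. 0 \<le> l \<Longrightarrow> \<phi> l \<le> exp (- l)"
  shows "\<forall>\<^sub>F n in sequentially. \<forall>u\<ge>0.
    \<phi> (u / (real n * ln (real n))) ^ n \<le> exp (- (u * (c / 4))) + exp (- sqrt u)"
proof -
  have "\<forall>\<^sub>F l in at_right 0. c / 2 < (1 - \<phi> l) / (l * ln (1 / l))"
    using order_tendstoD(1)[OF lim, of "c / 2"] c by simp
  then obtain d where d: "d > 0"
      "\<And>l. 0 < l \<Longrightarrow> l < d \<Longrightarrow> c / 2 < (1 - \<phi> l) / (l * ln (1 / l))"
    by (auto simp: eventually_at_right_field)
  have "(\<lambda>n. 1 / sqrt (real n)) \<longlonglongrightarrow> 0" by real_asymp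
  then have "\<forall>\<^sub>F n in sequentially. 1 / sqrt (real n) < d"
    using d by (auto simp: order_tendsto_iff)
  moreover have "\<forall>\<^sub>F n in sequentially. ln (real n) \<le> sqrt (real n)" by real_asymp
  ultimately show ?thesis using eventually_ge_at_top[of 2]
  proof eventually_elim
    case (elim n)
    define L where "L = ln (real n)"
    have L: "0 < L" "L \<le> sqrt (real n)" and n: "2 \<le> real n" using elim by (auto simp: L_def)
    show ?case
    proof (intro allI impI)
      fix u :: real assume u: "0 \<le> u"
      define l where "l = u / (real n * L)"
      have l0: "0 \<le> l" using u L by (simp add: l_def)
      \<comment> \<open>The threshold corresponds to \<open>l = 1 / sqrt n\<close>: below it
        \<open>l\<close> lies in the range \<open>l < d\<close> of the asymptotics, and
        \<open>ln (1 / l)\<close> is at least half of \<open>L\<close>.\<close>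
      consider "u = 0" | "0 < u" "u \<le> sqrt (real n) * L" | "sqrt (real n) * L < u"
        using u by linarith
      then have "\<phi> l ^ n \<le> exp (- (u * (c / 4))) + exp (- sqrt u)"
      proof cases
        case 1
        have "\<phi> l ^ n \<le> 1" using le[of l] nonneg[of l] 1 by (intro power_le_one) (auto simp: l_def)
        then show ?thesis using 1 by simp
      next
        case 2
        have lp: "0 < l" using 2 L n by (simp add: l_def)
        have "l \<le> sqrt (real n) * L / (real n * L)"
          unfolding l_def using 2 L n by (intro divide_right_mono) auto
        also have "\<dots> = 1 / sqrt (real n)" using L n by (simp add: field_simps)
        finally have l_le: "l \<le> 1 / sqrt (real n)" .
        have "sqrt (real n) \<le> 1 / l" using l_le lp n by (simp add: field_simps)
        then have "ln (sqrt (real n)) \<le> ln (1 / l)" using lp n by (subst ln_le_cancel_iff) auto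
        then have ln_ge: "L / 2 \<le> ln (1 / l)" using n by (simp add: ln_sqrt L_def)
        then have lnp: "0 < l * ln (1 / l)" using L lp by (intro mult_pos_pos) linarith+
        have "u * (c / 4) = real n * (c / 2 * (l * (L / 2)))"
          using L n by (simp add: l_def)
        also have "\<dots> \<le> real n * (c / 2 * (l * ln (1 / l)))"
          using ln_ge lp c by (intro mult_left_mono) auto
        also have "\<dots> \<le> real n * (1 - \<phi> l)"
          using d(2)[of l] lp l_le elim(1) lnp by (intro mult_left_mono) (auto simp: field_simps)
        finally have ge: "u * (c / 4) \<le> real n * (1 - \<phi> l)" .
        \<comment> \<open>This is \<open>1 + z \<le> exp z\<close> at
          \<open>z = \<phi> l - 1\<close>.\<close>
        have "\<phi> l ^ n \<le> exp (- (1 - \<phi> l)) ^ n"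
          using exp_ge_add_one_self[of "- (1 - \<phi> l)"] nonneg by (intro power_mono) auto
        also have "\<dots> = exp (- (real n * (1 - \<phi> l)))"
          by (simp add: algebra_simps flip: exp_of_nat_mult)
        also have "\<dots> \<le> exp (- (u * (c / 4)))" using ge by simp
        finally show ?thesis by (smt (verit) exp_gt_zero)
      next
        case 3
        \<comment> \<open>The aim is \<open>L \<le> sqrt u\<close>, which gives
          \<open>n * l = u / L \<ge> sqrt u\<close>.\<close>
        have "L\<^sup>2 \<le> sqrt (real n) * L" using L by (simp add: power2_eq_square)
        then have "L\<^sup>2 \<le> u" using 3 by simp
        then have "L \<le> sqrt u" by (rule real_le_rsqrt)
        then have "sqrt u * L \<le> sqrt u * sqrt u" using u by (intro mult_left_mono) auto
        then have ge: "sqrt u \<le> real n * l" using u L n by (simp add: l_def field_simps)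
        have "\<phi> l ^ n \<le> exp (- l) ^ n" using le[OF l0] nonneg by (intro power_mono) auto
        also have "\<dots> = exp (- (real n * l))" by (simp flip: exp_of_nat_mult)
        also have "\<dots> \<le> exp (- sqrt u)" using ge by simp
        finally show ?thesis by (smt (verit) exp_gt_zero)
      qed
      then show "\<phi> (u / (real n * ln (real n))) ^ n \<le> exp (- (u * (c / 4))) + exp (- sqrt u)"
        by (simp add: l_def L_def)
    qed
  qed
qed

section \<open>Integral representation of the expected harmonic mean\<close>

text \<open>The scaled harmonic mean is \<open>1 / r\<close> with \<open>r = S / (n K)\<close>,
  hence almost surely the integral of \<open>exp (- u r)\<close> over \<open>u \<ge> 0\<close>.
  Tonelli moves the expectation inside, where independence gives a product of \<open>n\<close> equal
  factors.\<close>

lemma (in prob_space) expectation_harmonic_mean_laplace: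
  fixes x :: "nat \<Rightarrow> 'a \<Rightarrow> real" and \<phi> :: "real \<Rightarrow> real"
  assumes indep: "indep_vars (\<lambda>_. borel) x {1..}"
    and nonneg: "\<And>i \<omega>. i \<ge> 1 \<Longrightarrow> \<omega> \<in> space M \<Longrightarrow> 0 \<le> x i \<omega>"
    and pos: "\<And>i. i \<ge> 1 \<Longrightarrow> AE \<omega> in M. 0 < x i \<omega>"
    and \<phi>: "\<And>i l. i \<ge> 1 \<Longrightarrow> expectation (\<lambda>\<omega>. exp (- (l / x i \<omega>))) = \<phi> l"
    and n: "n \<ge> 1" and K: "0 < K"
  shows "expectation (\<lambda>\<omega>. harmonic_mean (\<lambda>i. x i \<omega>) n * K)
    = (\<integral>u. \<phi> (u / (real n * K)) ^ n * indicator {0..} u \<partial>lborel)"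
proof -
  define S where "S \<omega> = (\<Sum>i=1..n. 1 / x i \<omega>)" for \<omega>
  have x_m: "x i \<in> borel_measurable M" if "i \<ge> 1" for i
    using indep that unfolding indep_vars_def by auto
  have S_m[measurable]: "S \<in> borel_measurable M"
    unfolding S_def using x_m by (intro borel_measurable_sum borel_measurable_divide) auto
  have H: "harmonic_mean (\<lambda>i. x i \<omega>) n * K = 1 / (S \<omega> / (real n * K))" for \<omega>
    using n K by (simp add: harmonic_mean_def reciprocal_mean_def S_def field_simps)
  have S0: "0 \<le> S \<omega>" if "\<omega> \<in> space M" for \<omega>
    using nonneg that by (auto simp: S_def intro!: sum_nonneg)
  \<comment> \<open>The integral formula for \<open>1 / r\<close> needs \<open>r > 0\<close>, so the
    points with \<open>S \<omega> = 0\<close> have to be null.\<close>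
  have "AE \<omega> in M. \<forall>i\<in>{1..n}. 0 < x i \<omega>"
    using pos by (intro AE_finite_allI) auto
  then have S_pos: "AE \<omega> in M. 0 < S \<omega>"
    by eventually_elim (use n in \<open>auto simp: S_def intro!: sum_pos\<close>)
  have [measurable]: "x 1 \<in> borel_measurable M" using x_m by simp
  have \<phi>_eq: "\<phi> = (\<lambda>l. expectation (\<lambda>\<omega>. exp (- (l / x 1 \<omega>))))" using \<phi>[of 1] by auto
  have \<phi>_m[measurable]: "\<phi> \<in> borel_measurable borel"
    unfolding \<phi>_eq by measurable
  have \<phi>0: "0 \<le> \<phi> l" for l unfolding \<phi>_eq by simp
  interpret P: pair_sigma_finite lborel M ..
  have E: "(\<integral>\<^sup>+\<omega>. ennreal (exp (- (u * (S \<omega> / (real n * K))))) \<partial>M) = ennreal (\<phi> (u / (real n * K)) ^ n)"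
    if u: "0 \<le> u" for u
  proof -
    define v where "v = u / (real n * K)"
    have v: "0 \<le> v" using u K by (simp add: v_def)
    have "(\<integral>\<^sup>+\<omega>. ennreal (exp (- (u * (S \<omega> / (real n * K))))) \<partial>M)
        = (\<integral>\<^sup>+\<omega>. (\<Prod>i\<in>{1..n}. ennreal (exp (- (v / x i \<omega>)))) \<partial>M)"
    proof (rule nn_integral_cong)
      fix \<omega>
      have "- (u * (S \<omega> / (real n * K))) = (\<Sum>i=1..n. - (v / x i \<omega>))"
        by (simp add: S_def v_def sum_negf sum_divide_distrib sum_distrib_left field_simps)
      then show "ennreal (exp (- (u * (S \<omega> / (real n * K))))) = (\<Prod>i\<in>{1..n}. ennreal (exp (- (v / x i \<omega>))))"
        by (simp add: exp_sum prod_ennreal)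
    qed
    also have "\<dots> = (\<Prod>i\<in>{1..n}. \<integral>\<^sup>+\<omega>. ennreal (exp (- (v / x i \<omega>))) \<partial>M)"
      by (intro indep_vars_nn_integral indep_vars_compose2[OF indep_vars_subset[OF indep]]) auto
    also have "\<dots> = (\<Prod>i\<in>{1..n}. ennreal (\<phi> v))"
    proof (rule prod.cong)
      fix i assume "i \<in> {1..n}"
      then have i: "i \<ge> 1" by simp
      have [measurable]: "x i \<in> borel_measurable M" using x_m i by simp
      have "integrable M (\<lambda>\<omega>. exp (- (v / x i \<omega>)))"
        by (rule integrable_const_bound[where B=1]) (use nonneg i v in auto)
      then show "(\<integral>\<^sup>+\<omega>. ennreal (exp (- (v / x i \<omega>))) \<partial>M) = ennreal (\<phi> v)"
        by (subst nn_integral_eq_integral) (use \<phi>[OF i] in auto)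
    qed simp
    also have "\<dots> = ennreal (\<phi> v ^ n)" using \<phi>0 by (simp add: ennreal_power)
    finally show ?thesis by (simp add: v_def)
  qed
  have "(\<integral>\<^sup>+\<omega>. ennreal (harmonic_mean (\<lambda>i. x i \<omega>) n * K) \<partial>M)
      = (\<integral>\<^sup>+\<omega>. \<integral>\<^sup>+u. ennreal (exp (- (u * (S \<omega> / (real n * K))))) * indicator {0..} u \<partial>lborel \<partial>M)"
  proof (rule nn_integral_cong_AE)
    show "AE \<omega> in M. ennreal (harmonic_mean (\<lambda>i. x i \<omega>) n * K)
        = (\<integral>\<^sup>+u. ennreal (exp (- (u * (S \<omega> / (real n * K))))) * indicator {0..} u \<partial>lborel)"
      using S_pos by eventually_elim (use n K in \<open>simp only: H, subst nn_integral_exp_scaled, auto\<close>)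
  qed
  also have "\<dots> = (\<integral>\<^sup>+u. \<integral>\<^sup>+\<omega>. ennreal (exp (- (u * (S \<omega> / (real n * K))))) * indicator {0..} u \<partial>M \<partial>lborel)"
    by (rule P.Fubini') measurable
  also have "\<dots> = (\<integral>\<^sup>+u. ennreal (\<phi> (u / (real n * K)) ^ n * indicator {0..} u) \<partial>lborel)"
    by (intro nn_integral_cong) (auto simp: indicator_def E simp del: times_divide_eq_right)
  finally have *: "(\<integral>\<^sup>+\<omega>. ennreal (harmonic_mean (\<lambda>i. x i \<omega>) n * K) \<partial>M) = \<dots>" .
  \<comment> \<open>Both integrands are nonnegative and measurable, so each real integral is
    \<open>enn2real\<close> of the corresponding nonnegative one; finiteness need not be
    checked.\<close>
  have "expectation (\<lambda>\<omega>. harmonic_mean (\<lambda>i. x i \<omega>) n * K)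
      = enn2real (\<integral>\<^sup>+\<omega>. ennreal (harmonic_mean (\<lambda>i. x i \<omega>) n * K) \<partial>M)"
    using S0 n K by (intro integral_eq_nn_integral) (auto simp: H intro!: AE_I2)
  also have "\<dots> = (\<integral>u. \<phi> (u / (real n * K)) ^ n * indicator {0..} u \<partial>lborel)"
    unfolding * using \<phi>0 by (intro integral_eq_nn_integral[symmetric]) (auto intro!: AE_I2)
  finally show ?thesis .
qed

section \<open>Convergence of the normalised expectation\<close>

theorem theoremE:
  fixes M :: "'a measure" and x :: "nat \<Rightarrow> 'a \<Rightarrow> real"
    and f :: "real \<Rightarrow> real" and c :: real
  assumes "prob_space M"
    and "prob_space.indep_vars M (\<lambda>_. borel) x {1..}"
    and "\<And>i \<omega>. i \<ge> 1 \<Longrightarrow> \<omega> \<in> space M \<Longrightarrow> x i \<omega> \<in> {0..1}"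
    and "\<And>t. f t \<ge> 0"
    and "\<And>i. i \<ge> 1 \<Longrightarrow> distributed M lborel (x i) (\<lambda>t. ennreal (f t))"
    and "c > 0"
    and "(f \<longlongrightarrow> c) (at_right 0)"
  shows "\<exists>C1 :: real.
    (\<lambda>n. prob_space.expectation M
           (\<lambda>\<omega>. harmonic_mean (\<lambda>i. x i \<omega>) n * ln (real n))) \<longlonglongrightarrow> C1"
proof -
  interpret prob_space M by fact
  note x_dist = assms(5)
  have x_m[measurable]: "x i \<in> borel_measurable M" if "i \<ge> 1" for i
    using distributed_measurable[OF x_dist[OF that]] by simp
  define \<phi> where "\<phi> l = expectation (\<lambda>\<omega>. exp (- (l / x 1 \<omega>)))" for l
  have \<phi>: "expectation (\<lambda>\<omega>. exp (- (l / x i \<omega>))) = \<phi> l" if "i \<ge> 1" for i l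
  proof -
    have m: "(\<lambda>t. exp (- (l / t))) \<in> borel_measurable lborel" by simp
    show ?thesis
      using distributed_integral[OF x_dist[OF that] m] distributed_integral[OF x_dist[of 1] m] assms(4)
      by (simp add: \<phi>_def)
  qed
  have nonneg: "0 \<le> x i \<omega>" if "i \<ge> 1" "\<omega> \<in> space M" for i \<omega>
    using assms(3)[OF that] by simp
  have pos: "AE \<omega> in M. 0 < x i \<omega>" if i: "i \<ge> 1" for i
  proof -
    \<comment> \<open>A variable with a density gives probability \<open>0\<close> to a single
      point.\<close>
    have "AE \<omega> in M. x i \<omega> \<noteq> 0"
      by (subst distributed_AE2[OF x_dist[OF i]]) (auto intro: AE_mp[OF AE_lborel_singleton[of 0]])
    then show ?thesis
      using AE_space by eventually_elim (use nonneg[OF i] in \<open>force simp: order.order_iff_strict\<close>)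
  qed
  have lim: "((\<lambda>l. (1 - \<phi> l) / (l * ln (1 / l))) \<longlongrightarrow> c) (at_right 0)"
    unfolding \<phi>_def using assms x_dist[of 1] nonneg[of 1] by (intro laplace_reciprocal_asymp) auto
  \<comment> \<open>This covers negative \<open>l\<close> as well: if the integrand is then not
    integrable, the expectation takes the default value \<open>0\<close>.\<close>
  have \<phi>_nonneg: "0 \<le> \<phi> l" for l by (simp add: \<phi>_def)
  have \<phi>_le: "\<phi> l \<le> exp (- l)" if l: "0 \<le> l" for l
  proof -
    have "\<phi> l \<le> expectation (\<lambda>_. exp (- l))"
      unfolding \<phi>_def
    proof (rule integral_mono_AE)
      show "integrable M (\<lambda>\<omega>. exp (- (l / x 1 \<omega>)))"
        by (rule integrable_const_bound[where B=1]) (use nonneg l in auto)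
      show "AE \<omega> in M. exp (- (l / x 1 \<omega>)) \<le> exp (- l)"
        using pos[OF order.refl] AE_space
      proof eventually_elim
        case (elim \<omega>)
        then show ?case using assms(3)[of 1 \<omega>] l by (simp add: field_simps mult_left_le)
      qed
    qed simp
    then show ?thesis by (simp add: prob_space)
  qed
  have \<phi>_m[measurable]: "\<phi> \<in> borel_measurable borel"
    unfolding \<phi>_def by measurable
  from laplace_power_dominated[OF lim assms(6) \<phi>_nonneg \<phi>_le]
  obtain N where N: "\<And>n u. n \<ge> N \<Longrightarrow> 0 \<le> u \<Longrightarrow>
      \<phi> (u / (real n * ln (real n))) ^ n \<le> exp (- (u * (c / 4))) + exp (- sqrt u)"
    by (auto simp: eventually_sequentially)
  define s where "s n u = \<phi> (u / (real n * ln (real n))) ^ n * indicator {0..} u" for n u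
  have s_m[measurable]: "s n \<in> borel_measurable borel" for n
    unfolding s_def by measurable
  \<comment> \<open>Dominated convergence asks for the bound at every index, while it holds only
    from \<open>N\<close> on; hence the shift.\<close>
  have "(\<lambda>n. \<integral>u. s (n + N) u \<partial>lborel) \<longlonglongrightarrow> (\<integral>u. exp (- (u * c)) * indicator {0..} u \<partial>lborel)"
  proof (rule integral_dominated_convergence)
    let ?w = "\<lambda>u. exp (- (u * (c / 4))) * indicator {0..} u + exp (- sqrt u) * indicator {0..} u"
    show "integrable lborel ?w"
      using assms(6) by (intro Bochner_Integration.integrable_add integrable_exp_scaled integrable_exp_minus_sqrt) simp
    show "AE u in lborel. norm (s (n + N) u) \<le> ?w u" for n
      using N[of "n + N"] \<phi>_nonneg by (intro AE_I2) (auto simp: s_def indicator_def)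
    have "(\<lambda>n. s n u) \<longlonglongrightarrow> exp (- (u * c)) * indicator {0..} u" for u
    proof (cases "0 < u")
      case True
      then show ?thesis using laplace_power_tendsto[OF lim assms(6) True] by (simp add: s_def)
    next
      case False
      \<comment> \<open>At \<open>u = 0\<close> every term is \<open>1\<close> since
        \<open>\<phi> 0 = 1\<close>; for negative \<open>u\<close> the indicator annihilates both
        sides.\<close>
      then show ?thesis by (cases "u = 0") (auto simp: s_def \<phi>_def prob_space)
    qed
    then show "AE u in lborel. (\<lambda>n. s (n + N) u) \<longlonglongrightarrow> exp (- (u * c)) * indicator {0..} u"
      by (intro AE_I2 LIMSEQ_ignore_initial_segment)
  qed auto
  then have "(\<lambda>n. \<integral>u. s n u \<partial>lborel) \<longlonglongrightarrow> (\<integral>u. exp (- (u * c)) * indicator {0..} u \<partial>lborel)"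
    by (rule LIMSEQ_offset)
  \<comment> \<open>The representation requires \<open>ln n > 0\<close>, hence
    \<open>n \<ge> 2\<close>.\<close>
  moreover have "\<forall>\<^sub>F n in sequentially.
      (\<integral>u. s n u \<partial>lborel) = expectation (\<lambda>\<omega>. harmonic_mean (\<lambda>i. x i \<omega>) n * ln (real n))"
    using eventually_ge_at_top[of 2]
  proof eventually_elim
    case (elim n)
    then show ?case
      unfolding s_def
      by (intro expectation_harmonic_mean_laplace[OF assms(2) nonneg pos \<phi>, symmetric]) auto
  qed
  ultimately show ?thesis
    by (blast intro: Lim_transform_eventually)
qed

end
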